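(* Define the sequence $a(n)$, $n\ge 180$, by $a(180)=360$ and, for $n\ge 181$, $$a(n)=\begin{cases}a(n-1)+1, & \text{if } \gcd\big(n+(-1)^n-1,\ a(n-1)\big)=1,\\ 3(n-2), & \text{otherwise}.\end{cases}$$ Call an integer $m\ge 180$ a fundamental point of this sequence if $m=6t$ for some integer $t$ and $a(m)=2m$. If the sequence $\{a(n)\}$ has infinitely many fundamental points, then there exist infinitely many twin primes. *)

theory Defs
  imports "HOL-Computational_Algebra.Primes"
begin

text \<open>
  The sequence starts at index 180; the value at smaller indices is arbitrary (set to 360) and is
  never used, since fundamental points are required to be at least 180. The values are integers
  so that the first argument of the gcd is not affected by truncated subtraction.
\<close>

fun a_seq :: "nat \<Rightarrow> int" where
  "a_seq n = (if n \<le> 180 then 360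
          else if gcd (int n + (-1) ^ n - 1) (a_seq (n - 1)) = 1 then a_seq (n - 1) + 1
          else 3 * (int n - 2))"

declare a_seq.simps [simp del]

lemma a_start: "a_seq 180 = 360"
  by (simp add: a_seq.simps)

lemma a_rec:
  assumes "n \<ge> 181"
  shows "a_seq n = (if gcd (int n + (-1) ^ n - 1) (a_seq (n - 1)) = 1 then a_seq (n - 1) + 1
                else 3 * (int n - 2))"
  using assms by (subst a_seq.simps) simp

definition fundamental_point :: "nat \<Rightarrow> bool" where
  "fundamental_point m \<longleftrightarrow> m \<ge> 180 \<and> (\<exists>t. m = 6 * t) \<and> a_seq m = 2 * int m"

end

theory Submission
  imports Defs
begin

text \<open>
  Call an index reset if the second branch of the recursion is taken there. A fundamental point
  \<open>m = 6 * t > 180\<close> has a last reset \<open>n\<close> before it, and \<open>a(m) = 2 * m\<close> forces \<open>n = 3 * t + 3\<close>. That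
  there is no reset in between says that \<open>6 * t - 1\<close> is coprime to all even numbers in
  \<open>(3 * t + 3, 6 * t]\<close> and \<open>6 * t + 1\<close> to all odd numbers in \<open>(3 * t + 1, 6 * t - 2]\<close>. If one of them
  were composite, it would have a prime factor \<open>p\<close> at most a fifth of it, as neither is divisible by
  2 or 3; then \<open>2 * p\<close> is less than the length of the interval, which thus contains a multiple of
  \<open>p\<close> of the required parity. So \<open>m - 1\<close> and \<open>m + 1\<close> are twin primes.
\<close>

text \<open>A reset at \<open>n\<close> gives the value \<open>3 * (n - 2)\<close>, and each later
  step adds 1, hence \<open>2 * n + M - 6\<close> at \<open>M\<close>. The coprimality at
  \<open>k\<close> involves the preceding value, hence the 7. The first disjunct is the case with no
  reset so far.\<close>

lemma a_seq_last_reset: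
  assumes "M \<ge> 180"
  shows "a_seq M = int M + 180 \<or>
    (\<exists>n\<ge>181. n \<le> M \<and> a_seq M = 2 * int n + int M - 6 \<and>
      (\<forall>k. n < k \<and> k \<le> M \<longrightarrow> coprime (int k + (-1) ^ k - 1) (2 * int n + int k - 7)))"
  using assms
proof (induction M rule: dec_induct)
  case base
  then show ?case by (simp add: a_start)
next
  case (step M)
  show ?case
  proof (cases "coprime (int (Suc M) + (-1) ^ Suc M - 1) (a_seq M)")
    case True
    with step.hyps have a: "a_seq (Suc M) = a_seq M + 1"
      by (simp add: a_rec coprime_iff_gcd_eq_1)
    from step.IH show ?thesis
    proof (elim disjE exE conjE)
      assume "a_seq M = int M + 180"
      with a show ?thesis by simp
    next
      fix n
      assume n: "181 \<le> n" "n \<le> M" and aM: "a_seq M = 2 * int n + int M - 6"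
        and c: "\<forall>k. n < k \<and> k \<le> M \<longrightarrow> coprime (int k + (-1) ^ k - 1) (2 * int n + int k - 7)"
      have "a_seq M = 2 * int n + int (Suc M) - 7" using aM by simp
      with True have "coprime (int (Suc M) + (-1) ^ Suc M - 1) (2 * int n + int (Suc M) - 7)"
        by (simp only:)
      with c have "\<forall>k. n < k \<and> k \<le> Suc M \<longrightarrow>
          coprime (int k + (-1) ^ k - 1) (2 * int n + int k - 7)"
        by (auto simp only: le_Suc_eq)
      moreover have "a_seq (Suc M) = 2 * int n + int (Suc M) - 6" using a aM by simp
      ultimately show ?thesis using n le_SucI by blast
    qed
  next
    case False
    then have "a_seq (Suc M) = 2 * int (Suc M) + int (Suc M) - 6"
      using step.hyps a_rec[of "Suc M"] by (simp add: coprime_iff_gcd_eq_1)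
    moreover have "Suc M \<ge> 181" using step.hyps by simp
    ultimately show ?thesis by (intro disjI2 exI[of _ "Suc M"]) auto
  qed
qed

text \<open>The cofactor of any prime factor exceeds 1 because \<open>N\<close> is not prime, and it
  is coprime to 6, so it is at least 5.\<close>

lemma composite_prime_factor:
  fixes N :: nat
  assumes "N > 1" "\<not> prime N" "\<not> 2 dvd N" "\<not> 3 dvd N"
  obtains p where "prime p" "p dvd N" "5 * p \<le> N"
proof -
  obtain p where p: "prime p" "p dvd N"
    using assms(1) prime_factor_nat[of N] by auto
  then obtain q where q: "N = p * q" by (elim dvdE)
  have "q \<noteq> 0" "q \<noteq> 1" "\<not> 2 dvd q" "\<not> 3 dvd q"
    using assms p q by auto
  moreover have "q = 0 \<or> q = 1 \<or> q = 2 \<or> q = 3 \<or> q = 4 \<or> q \<ge> 5" by arith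
  ultimately have "q \<ge> 5" by auto
  then have "5 * p \<le> N" using q by (simp add: mult.commute)
  with p that show thesis by blast
qed

lemma even_multiple_in_interval:
  fixes p a :: nat
  assumes "p > 0"
  obtains k where "even k" "p dvd k" "a < k" "k \<le> a + 2 * p"
proof
  let ?k = "2 * p * (a div (2 * p) + 1)"
  show "even ?k" "p dvd ?k" by auto
  have "2 * p * (a div (2 * p)) + a mod (2 * p) = a" "a mod (2 * p) < 2 * p"
    using assms by simp_all
  then show "a < ?k" "?k \<le> a + 2 * p"
    unfolding distrib_left mult_1_right by linarith+
qed

lemma odd_multiple_in_interval:
  fixes p a :: nat
  assumes "odd p"
  obtains k where "odd k" "p dvd k" "a < k" "k \<le> a + 2 * p"
proof
  \<comment> \<open>For odd \<open>p\<close> the odd multiples are the numbers congruent to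
    \<open>p\<close> modulo \<open>2 * p\<close>; this is the first one beyond
    \<open>a\<close>.\<close>
  let ?k = "2 * p * ((a + p) div (2 * p)) + p"
  show "odd ?k" "p dvd ?k" using assms by auto
  have "2 * p * ((a + p) div (2 * p)) + (a + p) mod (2 * p) = a + p" "(a + p) mod (2 * p) < 2 * p"
    using assms odd_pos by simp_all
  then show "a < ?k" "?k \<le> a + 2 * p"
    by linarith+
qed

lemma prime_pred_six:
  fixes t :: nat
  assumes "t \<ge> 5" and coprime: "\<And>k. \<lbrakk>even k; 3 * t + 3 < k; k \<le> 6 * t\<rbrakk> \<Longrightarrow> coprime k (6 * t - 1)"
  shows "prime (6 * t - 1)"
proof (rule ccontr)
  assume "\<not> prime (6 * t - 1)"
  moreover have "\<not> 2 dvd 6 * t - 1" "\<not> 3 dvd 6 * t - 1" "6 * t - 1 > 1"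
    using assms(1) by presburger+
  ultimately obtain p where p: "prime p" "p dvd 6 * t - 1" "5 * p \<le> 6 * t - 1"
    using composite_prime_factor by blast
  obtain k where k: "even k" "p dvd k" "3 * t + 3 < k" "k \<le> 3 * t + 3 + 2 * p"
    using even_multiple_in_interval p(1) prime_gt_0_nat by blast
  \<comment> \<open>With \<open>5 * p \<le> 6 * t - 1\<close> this amounts to
    \<open>13 \<le> 3 * t\<close>, whence the bound \<open>t \<ge> 5\<close>.\<close>
  have "k \<le> 6 * t" using k(4) p(3) assms(1) by linarith
  then have "coprime k (6 * t - 1)" using coprime k by blast
  then show False using k(2) p not_coprimeI not_prime_unit by blast
qed

lemma prime_succ_six:
  fixes t :: nat
  assumes "t \<ge> 6" and coprime: "\<And>k. \<lbrakk>odd k; 3 * t + 1 < k; k \<le> 6 * t - 2\<rbrakk> \<Longrightarrow> coprime k (6 * t + 1)"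
  shows "prime (6 * t + 1)"
proof (rule ccontr)
  assume "\<not> prime (6 * t + 1)"
  moreover have "\<not> 2 dvd 6 * t + 1" "\<not> 3 dvd 6 * t + 1" "6 * t + 1 > 1"
    using assms(1) by presburger+
  ultimately obtain p where p: "prime p" "p dvd 6 * t + 1" "5 * p \<le> 6 * t + 1"
    using composite_prime_factor by blast
  have "odd p" using p(2) \<open>\<not> 2 dvd 6 * t + 1\<close> dvd_trans by blast
  then obtain k where k: "odd k" "p dvd k" "3 * t + 1 < k" "k \<le> 3 * t + 1 + 2 * p"
    using odd_multiple_in_interval by blast
  \<comment> \<open>Here the requirement is \<open>17 \<le> 3 * t\<close>, whence
    \<open>t \<ge> 6\<close>.\<close>
  have "k \<le> 6 * t - 2" using k(4) p(3) assms(1) by linarith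
  then have "coprime k (6 * t + 1)" using coprime k by blast
  then show False using k(2) p not_coprimeI not_prime_unit by blast
qed

lemma fundamental_point_twin_primes:
  assumes "fundamental_point m" "m > 180"
  shows "prime (m - 1) \<and> prime (m + 1)"
proof -
  from assms obtain t where t: "m = 6 * t" and am: "a_seq m = 2 * int m"
    by (auto simp: fundamental_point_def)
  obtain n where n: "a_seq m = 2 * int n + int m - 6"
    and c: "\<And>k. \<lbrakk>n < k; k \<le> m\<rbrakk> \<Longrightarrow> coprime (int k + (-1) ^ k - 1) (2 * int n + int k - 7)"
    \<comment> \<open>Without a reset, \<open>m + 180 = 2 * m\<close> would force
      \<open>m = 180\<close>.\<close>
    using a_seq_last_reset[of m] assms(2) am by auto
  from n am t have n_eq: "n = 3 * t + 3" by simp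
  have "t \<ge> 6" using t assms(2) by simp
  have "prime (6 * t - 1)"
  proof (rule prime_pred_six)
    fix k :: nat assume k: "even k" "3 * t + 3 < k" "k \<le> 6 * t"
    \<comment> \<open>At an even index \<open>k\<close> the first argument of the gcd is
      \<open>k\<close> itself.\<close>
    have "coprime (int k) (int k + int (6 * t - 1))"
      using c[of k] k n_eq t \<open>t \<ge> 6\<close> by (simp add: of_nat_diff algebra_simps)
    then have "coprime (int k) (int (6 * t - 1))"
      by (simp only: coprime_iff_gcd_eq_1 gcd_add2)
    then show "coprime k (6 * t - 1)" by (simp only: coprime_int_iff)
  qed (use \<open>t \<ge> 6\<close> in simp)
  moreover have "prime (6 * t + 1)"
  proof (rule prime_succ_six)
    fix k :: nat assume k: "odd k" "3 * t + 1 < k" "k \<le> 6 * t - 2"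
    \<comment> \<open>At an odd index the first argument is the index minus 2, so the condition is
      taken at \<open>k + 2\<close>; this shifts both interval bounds by 2.\<close>
    have "coprime (int k) (int k + int (6 * t + 1))"
      using c[of "k + 2"] k n_eq t \<open>t \<ge> 6\<close> by (simp add: algebra_simps)
    then have "coprime (int k) (int (6 * t + 1))"
      by (simp only: coprime_iff_gcd_eq_1 gcd_add2)
    then show "coprime k (6 * t + 1)" by (simp only: coprime_int_iff)
  qed (use \<open>t \<ge> 6\<close> in simp)
  ultimately show ?thesis using t by simp
qed

theorem theorem5:
  assumes "infinite {m. fundamental_point m}"
  shows "infinite {p :: nat. prime p \<and> prime (p + 2)}"
proof -
  \<comment> \<open>The point 180 is fundamental by the initial value, not through a reset. On the
    remaining positive \<open>m\<close>, truncated \<open>m - 1\<close> is injective.\<close>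
  let ?F = "{m. fundamental_point m} - {..180}"
  have "infinite ?F" using assms by (simp add: Diff_infinite_finite)
  moreover have "inj_on (\<lambda>m. m - 1) ?F" by (auto intro!: inj_onI)
  ultimately have "infinite ((\<lambda>m. m - 1) ` ?F)" by (simp add: finite_image_iff)
  moreover have "(\<lambda>m. m - 1) ` ?F \<subseteq> {p. prime p \<and> prime (p + 2)}"
  proof
    fix p assume "p \<in> (\<lambda>m. m - 1) ` ?F"
    then obtain m where "p = m - 1" "m \<in> ?F" by (rule imageE)
    then have m: "p = m - 1" "fundamental_point m" "m > 180" by simp_all
    from m have "p + 2 = m + 1" by simp
    then show "p \<in> {p. prime p \<and> prime (p + 2)}"
      using fundamental_point_twin_primes[OF m(2,3)] m(1) by simp
  qed
  ultimately show ?thesis using finite_subset by blast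
qed

end
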